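(* Let $\mathsf X\subseteq\{\mathsf d,\mathsf t,\mathsf b,\mathsf 4,\mathsf 5\}$. If a nested sequent is provable in $\mathsf K_{\mathsf c}+[\mathsf X]$, then its corresponding formula is provable in a Hilbert system for the modal logic $\mathsf K$ extended by the axioms in $\mathsf X$.
   Context: Formulas: $A::=p\mid\bar p\mid A\vee A\mid A\wedge A\mid\Diamond A\mid\Box A$, $\bar A$ by De Morgan laws. A nested sequent is a finite multiset of formulas and boxed sequents $[\Delta]$; the corresponding formula of $A_1,\dots,A_m,[\Delta_1],\dots,[\Delta_n]$ is $A_1\vee\dots\vee A_m\vee\Box F_1\vee\dots\vee\Box F_n$ ($F_j$ that of $\Delta_j$; $\bot$ if empty). Contexts $\Gamma\{\ \}$, filling, binary contexts, and depth of $\Gamma\{\ \}\{\emptyset\}$ (boxes around the first hole) as usual. System $\mathsf K_{\mathsf c}$ (premises / conclusion): axiom $\Gamma\{p,\bar p\}$; $\wedge$: $\Gamma\{A\},\Gamma\{B\}/\Gamma\{A\wedge B\}$; $\vee$: $\Gamma\{A,B\}/\Gamma\{A\vee B\}$; $\Box$: $\Gamma\{[A]\}/\Gamma\{\Box A\}$; $\mathsf k$: $\Gamma\{[A,\Delta]\}/\Gamma\{\Diamond A,[\Delta]\}$; $\mathsf{ctr}$: $\Gamma\{\Delta,\Delta\}/\Gamma\{\Delta\}$. Structural modal rules: $[\mathsf d]$: $\Gamma\{[\emptyset]\}/\Gamma\{\emptyset\}$; $[\mathsf t]$: $\Gamma\{[\Delta]\}/\Gamma\{\Delta\}$; $[\mathsf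 b]$: $\Gamma\{[\Delta,[\Sigma]]\}/\Gamma\{[\Delta],\Sigma\}$; $[\mathsf 4]$: $\Gamma\{[\Delta],[\Sigma]\}/\Gamma\{[[\Delta],\Sigma]\}$; $[\mathsf 5]$: $\Gamma\{[\Delta]\}\{\emptyset\}/\Gamma\{\emptyset\}\{[\Delta]\}$ provided depth of $\Gamma\{\ \}\{\emptyset\}>0$. $\mathsf K_{\mathsf c}+[\mathsf X]$ adds $[\rho]$ for $\rho\in\mathsf X$. Proofs are finite trees with axiom leaves. Modal axioms: $\mathsf d$: $\Box A\supset\Diamond A$; $\mathsf t$: $A\supset\Diamond A$; $\mathsf b$: $A\supset\Box\Diamond A$; $\mathsf 4$: $\Box A\supset\Box\Box A$; $\mathsf 5$: $\Diamond A\supset\Box\Diamond A$. *)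

theory Defs
  imports "HOL-Library.Multiset"
begin

section \<open>Formulas\<close>

datatype 'p fm =
    Pos 'p
  | Neg 'p
  | Or "'p fm" "'p fm"
  | And "'p fm" "'p fm"
  | Dia "'p fm"
  | Box "'p fm"

primrec neg :: "'p fm \<Rightarrow> 'p fm" where
  "neg (Pos p) = Neg p"
| "neg (Neg p) = Pos p"
| "neg (Or A B) = And (neg A) (neg B)"
| "neg (And A B) = Or (neg A) (neg B)"
| "neg (Dia A) = Box (neg A)"
| "neg (Box A) = Dia (neg A)"

definition Imp :: "'p fm \<Rightarrow> 'p fm \<Rightarrow> 'p fm" where
  "Imp A B = Or (neg A) B"

text \<open>The language has no primitive falsum; it stands for a contradiction in an atom \<open>q\<close>
  that is fixed once and for all.\<close>

definition Bot :: "'p \<Rightarrow> 'p fm" where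
  "Bot q = And (Pos q) (Neg q)"

fun bigOr :: "'p \<Rightarrow> 'p fm list \<Rightarrow> 'p fm" where
  "bigOr q [] = Bot q"
| "bigOr q [A] = A"
| "bigOr q (A # B # As) = Or A (bigOr q (B # As))"

section \<open>Nested sequents\<close>

datatype 'p item = Fm "'p fm" | Bx "'p item multiset"

type_synonym 'p nseq = "'p item multiset"

text \<open>A multiset determines its corresponding formula only up to the order of the disjuncts, at
  every level of nesting.  \<open>corr_fm q S F\<close> holds iff \<open>F\<close> results from some choice of these orders,
  with the formulas of a sequent preceding its boxed sequents and disjunctions nested to the
  right.\<close>

inductive corr_fm :: "'p \<Rightarrow> 'p nseq \<Rightarrow> 'p fm \<Rightarrow> bool" for q where
  "list_all2 (corr_fm q) Ds Fs \<Longrightarrow>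
     corr_fm q (mset (map Fm As) + mset (map Bx Ds)) (bigOr q (As @ map Box Fs))"
  monos list_all2_mono

section \<open>Contexts\<close>

text \<open>A context lists what surrounds its hole: \<open>Here \<Gamma>\<close> is \<open>\<Gamma>, { }\<close> and \<open>Under \<Gamma> C\<close> is
  \<open>\<Gamma>, [C{ }]\<close>.\<close>

datatype 'p ctx = Here "'p nseq" | Under "'p nseq" "'p ctx"

primrec fill :: "'p ctx \<Rightarrow> 'p nseq \<Rightarrow> 'p nseq" where
  "fill (Here \<Gamma>) \<Delta> = \<Gamma> + \<Delta>"
| "fill (Under \<Gamma> C) \<Delta> = \<Gamma> + {#Bx (fill C \<Delta>)#}"

primrec depth :: "'p ctx \<Rightarrow> nat" where
  "depth (Here \<Gamma>) = 0"
| "depth (Under \<Gamma> C) = Suc (depth C)"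

text \<open>Binary contexts, according to where the two (ordered) holes lie, with holes numbered here
  for readability:
  \<open>Both_here \<Gamma>\<close> is \<open>\<Gamma>, { }1, { }2\<close>;
  \<open>Fst_here \<Gamma> C\<close> is \<open>\<Gamma>, { }1, [C{ }2]\<close>;
  \<open>Snd_here \<Gamma> C\<close> is \<open>\<Gamma>, [C{ }1], { }2\<close>;
  \<open>Apart \<Gamma> C D\<close> is \<open>\<Gamma>, [C{ }1], [D{ }2]\<close>;
  \<open>Under2 \<Gamma> G\<close> is \<open>\<Gamma>, [G{ }1{ }2]\<close>.\<close>

datatype 'p ctx2 =
    Both_here "'p nseq"
  | Fst_here "'p nseq" "'p ctx"
  | Snd_here "'p nseq" "'p ctx"
  | Apart "'p nseq" "'p ctx" "'p ctx"
  | Under2 "'p nseq" "'p ctx2"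

text \<open>\<open>fill_snd G \<Sigma>\<close> is the unary context \<open>G{ }{\<Sigma>}\<close>.\<close>

primrec fill_snd :: "'p ctx2 \<Rightarrow> 'p nseq \<Rightarrow> 'p ctx" where
  "fill_snd (Both_here \<Gamma>) \<Sigma> = Here (\<Gamma> + \<Sigma>)"
| "fill_snd (Fst_here \<Gamma> C) \<Sigma> = Here (\<Gamma> + {#Bx (fill C \<Sigma>)#})"
| "fill_snd (Snd_here \<Gamma> C) \<Sigma> = Under (\<Gamma> + \<Sigma>) C"
| "fill_snd (Apart \<Gamma> C D) \<Sigma> = Under (\<Gamma> + {#Bx (fill D \<Sigma>)#}) C"
| "fill_snd (Under2 \<Gamma> G) \<Sigma> = Under \<Gamma> (fill_snd G \<Sigma>)"

definition fill2 :: "'p ctx2 \<Rightarrow> 'p nseq \<Rightarrow> 'p nseq \<Rightarrow> 'p nseq" where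
  "fill2 G \<Delta> \<Sigma> = fill (fill_snd G \<Sigma>) \<Delta>"

section \<open>Nested sequent systems\<close>

datatype modal_ax = Ax_d | Ax_t | Ax_b | Ax_4 | Ax_5

inductive nested :: "modal_ax set \<Rightarrow> 'p nseq \<Rightarrow> bool" for X where
  n_id: "nested X (fill C {#Fm (Pos p), Fm (Neg p)#})"
| n_and: "nested X (fill C {#Fm A#}) \<Longrightarrow> nested X (fill C {#Fm B#}) \<Longrightarrow>
    nested X (fill C {#Fm (And A B)#})"
| n_or: "nested X (fill C {#Fm A, Fm B#}) \<Longrightarrow> nested X (fill C {#Fm (Or A B)#})"
| n_box: "nested X (fill C {#Bx {#Fm A#}#}) \<Longrightarrow> nested X (fill C {#Fm (Box A)#})"
| n_k: "nested X (fill C {#Bx ({#Fm A#} + \<Delta>)#}) \<Longrightarrow> nested X (fill C {#Fm (Dia A), Bx \<Delta>#})"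
| n_ctr: "nested X (fill C (\<Delta> + \<Delta>)) \<Longrightarrow> nested X (fill C \<Delta>)"
| n_d: "Ax_d \<in> X \<Longrightarrow> nested X (fill C {#Bx {#}#}) \<Longrightarrow> nested X (fill C {#})"
| n_t: "Ax_t \<in> X \<Longrightarrow> nested X (fill C {#Bx \<Delta>#}) \<Longrightarrow> nested X (fill C \<Delta>)"
| n_b: "Ax_b \<in> X \<Longrightarrow> nested X (fill C {#Bx (\<Delta> + {#Bx \<Sigma>#})#}) \<Longrightarrow>
    nested X (fill C ({#Bx \<Delta>#} + \<Sigma>))"
| n_4: "Ax_4 \<in> X \<Longrightarrow> nested X (fill C {#Bx \<Delta>, Bx \<Sigma>#}) \<Longrightarrow>
    nested X (fill C {#Bx ({#Bx \<Delta>#} + \<Sigma>)#})"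
| n_5: "Ax_5 \<in> X \<Longrightarrow> depth (fill_snd G {#}) > 0 \<Longrightarrow> nested X (fill2 G {#Bx \<Delta>#} {#}) \<Longrightarrow>
    nested X (fill2 G {#} {#Bx \<Delta>#})"

section \<open>Hilbert systems\<close>

datatype pform = PVar nat | PNot pform | POr pform pform | PAnd pform pform

primrec pval :: "(nat \<Rightarrow> bool) \<Rightarrow> pform \<Rightarrow> bool" where
  "pval v (PVar n) = v n"
| "pval v (PNot P) = (\<not> pval v P)"
| "pval v (POr P Q) = (pval v P \<or> pval v Q)"
| "pval v (PAnd P Q) = (pval v P \<and> pval v Q)"

primrec psubst :: "(nat \<Rightarrow> 'p fm) \<Rightarrow> pform \<Rightarrow> 'p fm" where
  "psubst s (PVar n) = s n"
| "psubst s (PNot P) = neg (psubst s P)"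
| "psubst s (POr P Q) = Or (psubst s P) (psubst s Q)"
| "psubst s (PAnd P Q) = And (psubst s P) (psubst s Q)"

primrec modal_ax_inst :: "modal_ax \<Rightarrow> 'p fm \<Rightarrow> 'p fm" where
  "modal_ax_inst Ax_d A = Imp (Box A) (Dia A)"
| "modal_ax_inst Ax_t A = Imp A (Dia A)"
| "modal_ax_inst Ax_b A = Imp A (Box (Dia A))"
| "modal_ax_inst Ax_4 A = Imp (Box A) (Box (Box A))"
| "modal_ax_inst Ax_5 A = Imp (Dia A) (Box (Dia A))"

text \<open>The duality of \<open>\<box>\<close> and \<open>\<diamond>\<close> needs no axiom, as negation is defined by the De Morgan laws.\<close>

inductive hilbert :: "modal_ax set \<Rightarrow> 'p fm \<Rightarrow> bool" for X where
  h_taut: "(\<And>v. pval v P) \<Longrightarrow> hilbert X (psubst s P)"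
| h_k: "hilbert X (Imp (Box (Imp A B)) (Imp (Box A) (Box B)))"
| h_ax: "a \<in> X \<Longrightarrow> hilbert X (modal_ax_inst a A)"
| h_mp: "hilbert X (Imp A B) \<Longrightarrow> hilbert X A \<Longrightarrow> hilbert X B"
| h_nec: "hilbert X A \<Longrightarrow> hilbert X (Box A)"

section \<open>Every nested sequent has a corresponding formula\<close>

lemma mset_items_split:
  obtains As Ds where "S = mset (map Fm As) + mset (map Bx Ds)"
proof -
  have "\<exists>As Ds. S = mset (map Fm As) + mset (map Bx Ds)"
  proof (induction S)
    case empty
    show ?case by (intro exI[of _ "[]"]) simp
  next
    case (add x S)
    then obtain As Ds where S: "S = mset (map Fm As) + mset (map Bx Ds)" by blast
    show ?case
    proof (cases x)
      case (Fm A)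
      then show ?thesis by (intro exI[of _ "A # As"] exI[of _ Ds]) (simp add: S)
    next
      case (Bx D)
      then show ?thesis by (intro exI[of _ As] exI[of _ "D # Ds"]) (simp add: S)
    qed
  qed
  then show ?thesis using that by blast
qed

lemma corr_fm_total_aux:
  assumes "\<And>D. Bx D \<in># S \<Longrightarrow> \<exists>F. corr_fm q D F"
  shows "\<exists>F. corr_fm q S F"
proof -
  obtain As Ds where S: "S = mset (map Fm As) + mset (map Bx Ds)" by (rule mset_items_split)
  have "\<forall>D\<in>set Ds. \<exists>F. corr_fm q D F" using assms S by auto
  then obtain f where "\<forall>D\<in>set Ds. corr_fm q D (f D)" by metis
  then have "list_all2 (corr_fm q) Ds (map f Ds)"
    by (simp add: list_all2_conv_all_nth)
  from corr_fm.intros[OF this] show ?thesis unfolding S by blast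
qed

lemma corr_fm_total: "\<exists>F. corr_fm q S F"
proof (rule corr_fm_total_aux)
  fix D :: "'a nseq"
  have "\<forall>D. x = Bx D \<longrightarrow> (\<exists>F. corr_fm q D F)" for x :: "'a item"
    by (induction x) (auto intro: corr_fm_total_aux)
  then show "\<exists>F. corr_fm q D F" by blast
qed

end

theory Submission imports Defs begin

text \<open>The proof is semantic. Every rule of the nested system preserves truth at each world of a
  frame having the properties that correspond to \<open>X\<close>, and the Hilbert system is complete for these
  frames: its canonical model, whose worlds are the maximal theories, is built on one of them, since
  all five modal axioms are canonical. A sequent and any of its corresponding formulas are true at
  the same worlds.\<close>

section \<open>Kripke semantics\<close>

primrec fsat :: "('w \<Rightarrow> 'w \<Rightarrow> bool) \<Rightarrow> ('p \<Rightarrow> 'w \<Rightarrow> bool) \<Rightarrow> 'w \<Rightarrow> 'p fm \<Rightarrow> bool" where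
  "fsat R V w (Pos p) = V p w"
| "fsat R V w (Neg p) = (\<not> V p w)"
| "fsat R V w (Or A B) = (fsat R V w A \<or> fsat R V w B)"
| "fsat R V w (And A B) = (fsat R V w A \<and> fsat R V w B)"
| "fsat R V w (Dia A) = (\<exists>v. R w v \<and> fsat R V v A)"
| "fsat R V w (Box A) = (\<forall>v. R w v \<longrightarrow> fsat R V v A)"

text \<open>The recursion reaches the members of a boxed sequent only through
  \<open>image_mset\<close>. The value is therefore a predicate on worlds, which can be evaluated at
  every successor.\<close>

primrec isat :: "('w \<Rightarrow> 'w \<Rightarrow> bool) \<Rightarrow> ('p \<Rightarrow> 'w \<Rightarrow> bool) \<Rightarrow> 'p item \<Rightarrow> 'w \<Rightarrow> bool" where
  "isat R V (Fm A) = (\<lambda>w. fsat R V w A)"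
| "isat R V (Bx \<Delta>) = (\<lambda>w. \<forall>v. R w v \<longrightarrow> (\<exists>f \<in># image_mset (isat R V) \<Delta>. f v))"

definition sat :: "('w \<Rightarrow> 'w \<Rightarrow> bool) \<Rightarrow> ('p \<Rightarrow> 'w \<Rightarrow> bool) \<Rightarrow> 'w \<Rightarrow> 'p nseq \<Rightarrow> bool" where
  "sat R V w S \<longleftrightarrow> (\<exists>x \<in># S. isat R V x w)"

lemma sat_empty [simp]: "\<not> sat R V w {#}"
  by (simp add: sat_def)

lemma sat_add_mset [simp]: "sat R V w (add_mset x S) \<longleftrightarrow> isat R V x w \<or> sat R V w S"
  by (auto simp: sat_def)

lemma sat_union [simp]: "sat R V w (S + T) \<longleftrightarrow> sat R V w S \<or> sat R V w T"
  by (auto simp: sat_def)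

lemma isat_Bx [simp]: "isat R V (Bx \<Delta>) w \<longleftrightarrow> (\<forall>v. R w v \<longrightarrow> sat R V v \<Delta>)"
  by (simp add: sat_def)

declare isat.simps(2) [simp del]

lemma fsat_bigOr: "fsat R V w (bigOr q As) \<longleftrightarrow> (\<exists>A \<in> set As. fsat R V w A)"
  by (induction q As rule: bigOr.induct) (auto simp: Bot_def)

text \<open>Truth of a disjunction ignores the order of the disjuncts, and \<open>Bot q\<close>
  fails everywhere, as the empty sequent does.\<close>

lemma fsat_corr_fm:
  assumes "corr_fm q S F"
  shows "fsat R V w F \<longleftrightarrow> sat R V w S"
  using assms
proof (induction arbitrary: w rule: corr_fm.induct)
  case (1 Ds Fs As)
  then have *: "list_all2 (\<lambda>D F. \<forall>w. fsat R V w F \<longleftrightarrow> sat R V w D) Ds Fs"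
    by (auto elim: list_all2_mono)
  have "(\<exists>F \<in> set Fs. fsat R V w (Box F)) \<longleftrightarrow> (\<exists>D \<in> set Ds. isat R V (Bx D) w)"
    using * by (induction rule: list_all2_induct) auto
  then show ?case
    by (simp add: fsat_bigOr sat_def bex_Un del: isat_Bx fsat.simps(6))
qed

section \<open>Soundness of the nested systems\<close>

text \<open>The carrier \<open>W\<close> is explicit because the canonical worlds are only some of
  the sets of formulas; seriality and reflexivity are demanded on \<open>W\<close> alone.\<close>

locale frame =
  fixes X :: "modal_ax set" and W :: "'w set" and R :: "'w \<Rightarrow> 'w \<Rightarrow> bool"
  assumes dom: "R w v \<Longrightarrow> w \<in> W \<and> v \<in> W"
    and serial: "Ax_d \<in> X \<Longrightarrow> w \<in> W \<Longrightarrow> \<exists>v. R w v"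
    and reflexive: "Ax_t \<in> X \<Longrightarrow> w \<in> W \<Longrightarrow> R w w"
    and symmetric: "Ax_b \<in> X \<Longrightarrow> R w v \<Longrightarrow> R v w"
    and transitive: "Ax_4 \<in> X \<Longrightarrow> R w v \<Longrightarrow> R v u \<Longrightarrow> R w u"
    and euclidean: "Ax_5 \<in> X \<Longrightarrow> R w v \<Longrightarrow> R w u \<Longrightarrow> R v u"
begin

lemma sat_fill_valid:
  assumes "\<And>w. w \<in> W \<Longrightarrow> sat R V w \<Delta>" and "w \<in> W"
  shows "sat R V w (fill C \<Delta>)"
  using assms by (induction C arbitrary: w) (auto dest: dom)

text \<open>A context is built from disjunctions with side formulas and boxes, which are monotone
  and distribute over conjunction. Two premises serve the rule for \<open>And\<close>.\<close>

lemma sat_fill_mono2: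
  assumes "\<And>w. w \<in> W \<Longrightarrow> sat R V w \<Delta> \<Longrightarrow> sat R V w \<Delta>' \<Longrightarrow> sat R V w \<Sigma>"
    and "sat R V w (fill C \<Delta>)" and "sat R V w (fill C \<Delta>')" and "w \<in> W"
  shows "sat R V w (fill C \<Sigma>)"
  using assms by (induction C arbitrary: w) (auto dest: dom)

lemma sat_fill_mono:
  assumes "sat R V w (fill C \<Delta>)" and "w \<in> W"
    and "\<And>w. w \<in> W \<Longrightarrow> sat R V w \<Delta> \<Longrightarrow> sat R V w \<Sigma>"
  shows "sat R V w (fill C \<Sigma>)"
  using assms by (blast intro: sat_fill_mono2)

text \<open>If the context fails with an empty hole, some successor owes its truth to the box. By
  Euclideanness that successor sees all successors of \<open>w\<close>, so the box rises one
  level.\<close>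

lemma sat_fill_Bx_up:
  assumes "Ax_5 \<in> X" and "sat R V w (fill C {#Bx \<Delta>#})" and "\<not> sat R V w (fill C {#})"
  shows "sat R V w {#Bx \<Delta>#}"
  using assms(2,3)
proof (induction C arbitrary: w)
  case (Under \<Gamma> C)
  then obtain v where v: "R w v" "sat R V v {#Bx \<Delta>#}" by auto
  then show ?case using euclidean[OF assms(1) v(1)] by simp
qed auto

text \<open>In a Euclidean frame, the worlds reachable from a world \<open>w\<close> that has a predecessor
  form a single cluster, so a boxed sequent has the same truth value in all of them.\<close>

lemma sat_fill_Bx_down:
  assumes "Ax_5 \<in> X" and "R u w" and "sat R V w {#Bx \<Delta>#}"
  shows "sat R V w (fill C {#Bx \<Delta>#})"
  using assms(2,3)
proof (induction C arbitrary: u w)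
  case (Under \<Gamma> C)
  have "sat R V v (fill C {#Bx \<Delta>#})" if "R w v" for v
  proof (rule Under.IH[OF that])
    \<comment> \<open>The predecessor \<open>u\<close> gives \<open>R w w\<close>, and this together
      with \<open>R w v\<close> gives \<open>R v w\<close>.\<close>
    have "R v w" using that Under.prems(1) euclidean[OF assms(1)] by blast
    then show "sat R V v {#Bx \<Delta>#}"
      using Under.prems(2) euclidean[OF assms(1), of v w] by simp
  qed
  then show ?case by simp
qed auto

lemma sat_fill_weaken:
  assumes "sat R V w (fill C {#})" and "w \<in> W"
  shows "sat R V w (fill C \<Delta>)"
  using assms by (rule sat_fill_mono) simp

text \<open>The side condition of rule [5] is weakened for the induction: below an outer box the
  depth may drop to 0, but the world reached then has a predecessor.\<close>

lemma sat_fill2_Bx: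
  assumes "Ax_5 \<in> X" and "w \<in> W" and "depth (fill_snd G {#}) > 0 \<or> (\<exists>u. R u w)"
    and "sat R V w (fill2 G {#Bx \<Delta>#} {#})"
  shows "sat R V w (fill2 G {#} {#Bx \<Delta>#})"
  using assms(2-) unfolding fill2_def
proof (induction G arbitrary: w)
  case (Both_here \<Gamma>)
  then show ?case by simp
next
  case (Fst_here \<Gamma> C)
  \<comment> \<open>The first hole has depth 0 here, so only the predecessor alternative remains.
    Wrapping \<open>C\<close> in \<open>Under {#}\<close> lets the box be pushed down from
    \<open>w\<close> itself.\<close>
  then obtain u where "R u w" by auto
  from sat_fill_Bx_down[OF assms(1) this, of V \<Delta> "Under {#} C"] Fst_here show ?case
    by (auto intro: sat_fill_weaken dest: dom)
next
  case (Snd_here \<Gamma> C)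
  then show ?case
    using sat_fill_Bx_up[OF assms(1), of V w "Under {#} C" \<Delta>] by auto
next
  case (Apart \<Gamma> C D)
  show ?case
  proof (cases "(\<forall>v. R w v \<longrightarrow> sat R V v (fill C {#})) \<or> \<not> (\<forall>v. R w v \<longrightarrow> sat R V v (fill C {#Bx \<Delta>#}))")
    case True
    then show ?thesis using Apart.prems by (auto intro: sat_fill_weaken dest: dom)
  next
    case False
    \<comment> \<open>At \<open>v\<close> the context \<open>C\<close> fails with an empty hole, so
      its box rises to \<open>v\<close>. Every sibling \<open>v'\<close> sees \<open>v\<close>,
      inherits the box, and passes it down into \<open>D\<close>.\<close>
    then obtain v where v: "R w v" "sat R V v {#Bx \<Delta>#}"
      using sat_fill_Bx_up[OF assms(1)] by blast
    have "sat R V v' (fill D {#Bx \<Delta>#})" if "R w v'" for v'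
    proof (rule sat_fill_Bx_down[OF assms(1) that])
      have "R v' v" by (rule euclidean[OF assms(1) that v(1)])
      then show "sat R V v' {#Bx \<Delta>#}" using v(2) euclidean[OF assms(1), of v' v] by simp
    qed
    then show ?thesis by auto
  qed
next
  case (Under2 \<Gamma> G)
  then show ?case by (auto dest: dom)
qed

lemma nested_sound:
  assumes "nested X S" and "w \<in> W"
  shows "sat R V w S"
  using assms
proof (induction arbitrary: w rule: nested.induct)
  case (n_id C p)
  then show ?case by (intro sat_fill_valid) auto
next
  case (n_and C A B)
  from n_and.IH(1)[OF n_and.prems] n_and.IH(2)[OF n_and.prems] n_and.prems show ?case
    by (rule sat_fill_mono2[rotated]) auto
next
  case (n_or C A B)
  from n_or.IH[OF n_or.prems] n_or.prems show ?case by (rule sat_fill_mono) auto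
next
  case (n_box C A)
  from n_box.IH[OF n_box.prems] n_box.prems show ?case by (rule sat_fill_mono) auto
next
  case (n_k C A \<Delta>)
  from n_k.IH[OF n_k.prems] n_k.prems show ?case by (rule sat_fill_mono) auto
next
  case (n_ctr C \<Delta>)
  from n_ctr.IH[OF n_ctr.prems] n_ctr.prems show ?case by (rule sat_fill_mono) auto
next
  case (n_d C)
  from n_d.IH[OF n_d.prems] n_d.prems show ?case
    by (rule sat_fill_mono) (simp, blast dest: serial[OF n_d.hyps(1)])
next
  case (n_t C \<Delta>)
  from n_t.IH[OF n_t.prems] n_t.prems show ?case
    by (rule sat_fill_mono) (simp, blast dest: reflexive[OF n_t.hyps(1)])
next
  case (n_b C \<Delta> \<Sigma>)
  from n_b.IH[OF n_b.prems] n_b.prems show ?case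
    \<comment> \<open>A successor falsifying \<open>\<Delta>\<close> satisfies the inner box and
      sees \<open>w\<close> again.\<close>
    by (rule sat_fill_mono) (simp, blast dest: symmetric[OF n_b.hyps(1)])
next
  case (n_4 C \<Delta> \<Sigma>)
  from n_4.IH[OF n_4.prems] n_4.prems show ?case
    by (rule sat_fill_mono) (simp, blast dest: transitive[OF n_4.hyps(1)])
next
  case (n_5 G \<Delta>)
  show ?case
    by (rule sat_fill2_Bx[OF n_5.hyps(1) n_5.prems disjI1[OF n_5.hyps(2)] n_5.IH[OF n_5.prems]])
qed

end

section \<open>Completeness of the Hilbert systems\<close>

lemma neg_neg [simp]: "neg (neg A) = A"
  by (induction A) auto

text \<open>Necessitation enters only through theorems, never applied to hypotheses; this is what
  makes the deduction theorem hold.\<close>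

inductive ded :: "modal_ax set \<Rightarrow> 'p fm set \<Rightarrow> 'p fm \<Rightarrow> bool" for X \<Gamma> where
  ded_hilbert: "hilbert X A \<Longrightarrow> ded X \<Gamma> A"
| ded_hyp: "A \<in> \<Gamma> \<Longrightarrow> ded X \<Gamma> A"
| ded_mp: "ded X \<Gamma> (Imp A B) \<Longrightarrow> ded X \<Gamma> A \<Longrightarrow> ded X \<Gamma> B"

lemma ded_mp_hilbert: "hilbert X (Imp A B) \<Longrightarrow> ded X \<Gamma> A \<Longrightarrow> ded X \<Gamma> B"
  by (rule ded_mp[OF ded_hilbert])

lemma ded_mp2_hilbert:
  "hilbert X (Imp A (Imp B C)) \<Longrightarrow> ded X \<Gamma> A \<Longrightarrow> ded X \<Gamma> B \<Longrightarrow> ded X \<Gamma> C"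
  by (rule ded_mp[OF ded_mp_hilbert])

lemma ded_empty: "ded X {} A \<Longrightarrow> hilbert X A"
  by (induction rule: ded.induct) (auto intro: h_mp)

lemma ded_trans: "ded X \<Gamma> A \<Longrightarrow> (\<And>B. B \<in> \<Gamma> \<Longrightarrow> ded X \<Delta> B) \<Longrightarrow> ded X \<Delta> A"
  by (induction rule: ded.induct) (auto intro: ded.intros)

lemma ded_mono: "ded X \<Gamma> A \<Longrightarrow> \<Gamma> \<subseteq> \<Delta> \<Longrightarrow> ded X \<Delta> A"
  by (erule ded_trans) (auto intro: ded_hyp)

text \<open>This replaces a finiteness argument: at each modus ponens the larger of the two chain
  members already found derives both premises.\<close>

lemma ded_Union_chain:
  assumes "ded X (\<Union>\<C>) A" and "subset.chain UNIV \<C>" and "\<C> \<noteq> {}"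
  shows "\<exists>\<Gamma> \<in> \<C>. ded X \<Gamma> A"
  using assms(1)
proof (induction rule: ded.induct)
  case (ded_mp A B)
  then obtain \<Gamma> \<Delta> where \<Gamma>: "\<Gamma> \<in> \<C>" "ded X \<Gamma> (Imp A B)" and \<Delta>: "\<Delta> \<in> \<C>" "ded X \<Delta> A" by blast
  then have "\<Gamma> \<subseteq> \<Delta> \<or> \<Delta> \<subseteq> \<Gamma>" using assms(2) by (auto simp: subset_chain_def)
  then show ?case using \<Gamma> \<Delta> by (meson ded.ded_mp ded_mono)
qed (use assms(3) in \<open>auto intro: ded.intros\<close>)

section \<open>Propositional theorems and the deduction theorem\<close>

definition imp_pform :: "pform \<Rightarrow> pform \<Rightarrow> pform" where
  "imp_pform P Q = POr (PNot P) Q"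

lemma pval_imp_pform [simp]: "pval v (imp_pform P Q) \<longleftrightarrow> (pval v P \<longrightarrow> pval v Q)"
  by (simp add: imp_pform_def)

lemma psubst_imp_pform [simp]: "psubst s (imp_pform P Q) = Imp (psubst s P) (psubst s Q)"
  by (simp add: imp_pform_def Imp_def)

text \<open>With the tautology given as a function of three letters, simplification computes its
  instance at \<open>A\<close>, \<open>B\<close>, \<open>C\<close>.\<close>

lemma hilbert_taut3:
  assumes "\<And>v. pval v (P (PVar 0) (PVar 1) (PVar 2))"
  shows "hilbert X (psubst (\<lambda>n. if n = 0 then A else if n = 1 then B else C)
    (P (PVar 0) (PVar 1) (PVar 2)))"
  using assms by (rule h_taut)

lemma hilbert_weaken: "hilbert X (Imp B (Imp A B))"
  using hilbert_taut3[of "\<lambda>a b c. imp_pform b (imp_pform a b)" X A B] by simp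

lemma hilbert_refl: "hilbert X (Imp A A)"
  using hilbert_taut3[of "\<lambda>a b c. imp_pform a a" X A] by simp

lemma hilbert_distrib: "hilbert X (Imp (Imp A (Imp B C)) (Imp (Imp A B) (Imp A C)))"
  using hilbert_taut3[of "\<lambda>a b c. imp_pform (imp_pform a (imp_pform b c))
    (imp_pform (imp_pform a b) (imp_pform a c))" X A B C] by simp

lemma hilbert_explosion: "hilbert X (Imp A (Imp (neg A) B))"
  using hilbert_taut3[of "\<lambda>a b c. imp_pform a (imp_pform (PNot a) b)" X A B] by simp

lemma hilbert_neg_cases: "hilbert X (Imp (Imp A B) (Imp (Imp (neg A) B) B))"
  using hilbert_taut3[of "\<lambda>a b c. imp_pform (imp_pform a b)
    (imp_pform (imp_pform (PNot a) b) b)" X A B] by auto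

lemma hilbert_Or1: "hilbert X (Imp A (Or A B))"
  using hilbert_taut3[of "\<lambda>a b c. imp_pform a (POr a b)" X A B] by simp

lemma hilbert_Or2: "hilbert X (Imp B (Or A B))"
  using hilbert_taut3[of "\<lambda>a b c. imp_pform b (POr a b)" X A B] by simp

lemma hilbert_Or_cases: "hilbert X (Imp (Imp A C) (Imp (Imp B C) (Imp (Or A B) C)))"
  using hilbert_taut3[of "\<lambda>a b c. imp_pform (imp_pform a c)
    (imp_pform (imp_pform b c) (imp_pform (POr a b) c))" X A B C] by simp

lemma deduction:
  assumes "ded X (insert A \<Gamma>) B"
  shows "ded X \<Gamma> (Imp A B)"
  using assms
proof (induction rule: ded.induct)
  case (ded_hilbert B)
  then show ?case by (intro ded_mp_hilbert[OF hilbert_weaken] ded.ded_hilbert)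
next
  case (ded_hyp B)
  then consider "B = A" | "B \<in> \<Gamma>" by blast
  then show ?case
    by cases (auto intro: ded.ded_hilbert hilbert_refl ded_mp_hilbert[OF hilbert_weaken] ded.ded_hyp)
next
  case (ded_mp B C)
  then show ?case by (blast intro: ded_mp2_hilbert[OF hilbert_distrib])
qed

section \<open>Maximal theories\<close>

definition max_theory :: "modal_ax set \<Rightarrow> 'p fm set \<Rightarrow> bool" where
  "max_theory X \<Gamma> \<longleftrightarrow> (\<forall>A. ded X \<Gamma> A \<longrightarrow> A \<in> \<Gamma>) \<and> (\<forall>A. neg A \<in> \<Gamma> \<longleftrightarrow> A \<notin> \<Gamma>) \<and>
    (\<forall>A B. Or A B \<in> \<Gamma> \<longleftrightarrow> A \<in> \<Gamma> \<or> B \<in> \<Gamma>)"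

text \<open>Zorn's lemma yields a set maximal among the extensions of \<open>\<Gamma>\<close> that
  do not derive \<open>F\<close>; here \<open>F\<close> plays the role of falsum.\<close>

lemma lindenbaum:
  assumes "\<not> ded X \<Gamma> F"
  obtains \<Delta> where "max_theory X \<Delta>" and "\<Gamma> \<subseteq> \<Delta>" and "F \<notin> \<Delta>"
proof -
  define \<A> where "\<A> = {\<Delta>. \<Gamma> \<subseteq> \<Delta> \<and> \<not> ded X \<Delta> F}"
  have "\<exists>M \<in> \<A>. \<forall>\<Delta> \<in> \<A>. M \<subseteq> \<Delta> \<longrightarrow> \<Delta> = M"
  proof (rule subset_Zorn_nonempty)
    show "\<A> \<noteq> {}" using assms by (auto simp: \<A>_def)
  next
    fix \<C> assume \<C>: "\<C> \<noteq> {}" "subset.chain \<A> \<C>"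
    then have "subset.chain UNIV \<C>" and sub: "\<C> \<subseteq> \<A>" by (auto simp: subset_chain_def)
    then have "\<not> ded X (\<Union>\<C>) F"
      using \<C>(1) ded_Union_chain[of X \<C> F] by (auto simp: \<A>_def)
    moreover have "\<Gamma> \<subseteq> \<Union>\<C>" using \<C>(1) sub by (auto simp: \<A>_def)
    ultimately show "\<Union>\<C> \<in> \<A>" by (simp add: \<A>_def)
  qed
  then obtain \<Delta> where \<Delta>: "\<Delta> \<in> \<A>" "\<forall>\<Delta>' \<in> \<A>. \<Delta> \<subseteq> \<Delta>' \<longrightarrow> \<Delta>' = \<Delta>" ..
  then have sub: "\<Gamma> \<subseteq> \<Delta>" and F: "\<not> ded X \<Delta> F" by (simp_all add: \<A>_def)
  have max: "\<Delta>' = \<Delta>" if "\<Delta> \<subseteq> \<Delta>'" "\<not> ded X \<Delta>' F" for \<Delta>'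
    using \<Delta>(2) sub that by (simp add: \<A>_def)
  \<comment> \<open>By maximality, adding a new formula makes \<open>F\<close> derivable. All
    remaining properties come from this.\<close>
  have imp_F: "ded X \<Delta> (Imp A F)" if "A \<notin> \<Delta>" for A
    using max[of "insert A \<Delta>"] that by (blast intro: deduction)
  have closed: "A \<in> \<Delta>" if "ded X \<Delta> A" for A
    using imp_F that F by (blast intro: ded_mp)
  have "A \<notin> \<Delta>" if "neg A \<in> \<Delta>" for A
    using that F ded_mp2_hilbert[OF hilbert_explosion] ded_hyp by metis
  moreover have "neg A \<in> \<Delta>" if "A \<notin> \<Delta>" for A
    \<comment> \<open>If \<open>neg A\<close> were missing as well, the two cases would together
      derive \<open>F\<close>.\<close>
    using imp_F[OF that] imp_F[of "neg A"] F
    by (blast intro: ded_mp2_hilbert[OF hilbert_neg_cases])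
  moreover have "A \<in> \<Delta> \<or> B \<in> \<Delta>" if "Or A B \<in> \<Delta>" for A B
    using imp_F[of A] imp_F[of B] ded_hyp[OF that] F ded_mp[OF ded_mp2_hilbert[OF hilbert_Or_cases]]
    by blast
  moreover have "Or A B \<in> \<Delta>" if "A \<in> \<Delta> \<or> B \<in> \<Delta>" for A B
    using that closed ded_hyp ded_mp_hilbert[OF hilbert_Or1] ded_mp_hilbert[OF hilbert_Or2] by metis
  ultimately have "max_theory X \<Delta>"
    using closed unfolding max_theory_def by blast
  moreover have "F \<notin> \<Delta>" using F by (blast intro: ded_hyp)
  ultimately show thesis using that sub by blast
qed

context
  fixes X :: "modal_ax set" and w :: "'p fm set"
  assumes w: "max_theory X w"
begin

lemma max_theory_hilbert: "hilbert X A \<Longrightarrow> A \<in> w"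
  using w by (auto simp: max_theory_def intro: ded_hilbert)

lemma max_theory_neg [simp]: "neg A \<in> w \<longleftrightarrow> A \<notin> w"
  using w by (simp add: max_theory_def)

lemma max_theory_Or [simp]: "Or A B \<in> w \<longleftrightarrow> A \<in> w \<or> B \<in> w"
  using w by (simp add: max_theory_def)

lemma max_theory_Imp [simp]: "Imp A B \<in> w \<longleftrightarrow> (A \<in> w \<longrightarrow> B \<in> w)"
  by (auto simp: Imp_def)

lemma max_theory_Neg [simp]: "Neg p \<in> w \<longleftrightarrow> Pos p \<notin> w"
  using max_theory_neg[of "Pos p"] by simp

lemma max_theory_And [simp]: "And A B \<in> w \<longleftrightarrow> A \<in> w \<and> B \<in> w"
  using max_theory_neg[of "And A B"] by auto

lemma max_theory_Dia: "Dia A \<in> w \<longleftrightarrow> Box (neg A) \<notin> w"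
  using max_theory_neg[of "Dia A"] by simp

text \<open>Necessitation covers the theorems, and axiom \<open>h_k\<close> carries modus ponens
  under the box.\<close>

lemma max_theory_Box_closed:
  assumes "ded X {B. Box B \<in> w} A"
  shows "Box A \<in> w"
  using assms
proof (induction rule: ded.induct)
  case (ded_hilbert A)
  then show ?case by (blast intro: max_theory_hilbert h_nec)
next
  case (ded_mp A B)
  then show ?case using max_theory_hilbert[OF h_k[of X A B]] by simp
qed simp

end

section \<open>The canonical model\<close>

definition canon :: "modal_ax set \<Rightarrow> 'p fm set \<Rightarrow> 'p fm set \<Rightarrow> bool" where
  "canon X w v \<longleftrightarrow> max_theory X w \<and> max_theory X v \<and> (\<forall>A. Box A \<in> w \<longrightarrow> A \<in> v)"

text \<open>If \<open>Box A\<close> is missing from \<open>w\<close>, the formulas boxed in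
  \<open>w\<close> do not derive \<open>A\<close>, so a maximal theory extending them omits
  \<open>A\<close> and is the required successor.\<close>

lemma canon_Box:
  assumes "max_theory X w"
  shows "Box A \<in> w \<longleftrightarrow> (\<forall>v. canon X w v \<longrightarrow> A \<in> v)"
proof
  assume all: "\<forall>v. canon X w v \<longrightarrow> A \<in> v"
  show "Box A \<in> w"
  proof (rule ccontr)
    assume "Box A \<notin> w"
    then have "\<not> ded X {B. Box B \<in> w} A" using max_theory_Box_closed[OF assms] by blast
    then obtain v where "max_theory X v" "{B. Box B \<in> w} \<subseteq> v" "A \<notin> v" by (rule lindenbaum)
    then show False using all assms by (auto simp: canon_def)
  qed
qed (auto simp: canon_def)

lemma canon_Dia:
  assumes "max_theory X w"
  shows "Dia A \<in> w \<longleftrightarrow> (\<exists>v. canon X w v \<and> A \<in> v)"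
  unfolding max_theory_Dia[OF assms] canon_Box[OF assms]
  by (auto simp: canon_def max_theory_neg)

lemma truth_lemma:
  "max_theory X w \<Longrightarrow> fsat (canon X) (\<lambda>p w. Pos p \<in> w) w A \<longleftrightarrow> A \<in> w"
proof (induction A arbitrary: w)
  case (Dia A)
  have "max_theory X v" if "canon X w v" for v using that by (simp add: canon_def)
  then show ?case using Dia.IH by (auto simp: canon_Dia[OF Dia.prems])
next
  case (Box A)
  have "max_theory X v" if "canon X w v" for v using that by (simp add: canon_def)
  then show ?case using Box.IH by (auto simp: canon_Box[OF Box.prems])
qed simp_all

lemma max_theory_ax:
  assumes "max_theory X w" and "a \<in> X"
  shows "modal_ax_inst a A \<in> w"
  using assms by (blast intro: max_theory_hilbert h_ax)

text \<open>The dual criterion for accessibility, suited to axioms that conclude a diamond: were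
  \<open>A\<close> missing from \<open>v\<close>, then \<open>neg A\<close> would be in
  \<open>v\<close> and \<open>Dia (neg A)\<close> in \<open>w\<close>, contradicting
  \<open>Box A\<close>.\<close>

lemma canonI:
  assumes "max_theory X w" and "max_theory X v" and "\<And>A. A \<in> v \<Longrightarrow> Dia A \<in> w"
  shows "canon X w v"
proof -
  have "A \<in> v" if "Box A \<in> w" for A
    using assms(3)[of "neg A"] that by (auto simp: max_theory_Dia[OF assms(1)] max_theory_neg[OF assms(2)])
  then show ?thesis using assms by (simp add: canon_def)
qed

lemma canon_frame: "frame X {w. max_theory X w} (canon X)"
proof
  fix w v u :: "'p fm set"
  show "w \<in> {w. max_theory X w} \<and> v \<in> {w. max_theory X w}" if "canon X w v"
    using that by (simp add: canon_def)
  show "\<exists>v. canon X w v" if "Ax_d \<in> X" "w \<in> {w. max_theory X w}"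
  proof -
    have w: "max_theory X w" using that by simp
    \<comment> \<open>Without successors every \<open>Box A\<close> would lie in \<open>w\<close>
      vacuously, hence also \<open>Dia A\<close>, which demands a successor.\<close>
    have "Box A \<in> w \<longrightarrow> Dia A \<in> w" for A
      using max_theory_ax[OF w that(1)] by (simp add: max_theory_Imp[OF w])
    then show ?thesis unfolding canon_Box[OF w] canon_Dia[OF w] by blast
  qed
  show "canon X w w" if "Ax_t \<in> X" "w \<in> {w. max_theory X w}"
  proof -
    have w: "max_theory X w" using that by simp
    show ?thesis
      using max_theory_ax[OF w that(1)] by (intro canonI w) (simp add: max_theory_Imp[OF w])
  qed
  show "canon X v w" if "Ax_b \<in> X" "canon X w v"
  proof -
    have wv: "max_theory X w" "max_theory X v" using that(2) by (auto simp: canon_def)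
    show ?thesis
      \<comment> \<open>For \<open>A\<close> in \<open>w\<close>, the axiom puts
        \<open>Box (Dia A)\<close> in \<open>w\<close> and so \<open>Dia A\<close> in
        \<open>v\<close>.\<close>
      using max_theory_ax[OF wv(1) that(1)] that(2)
      by (intro canonI wv) (auto simp: max_theory_Imp[OF wv(1)] canon_def)
  qed
  show "canon X w u" if "Ax_4 \<in> X" "canon X w v" "canon X v u"
  proof -
    have w: "max_theory X w" using that(2) by (auto simp: canon_def)
    show ?thesis
      using max_theory_ax[OF w that(1)] that(2,3)
      by (auto simp: max_theory_Imp[OF w] canon_def)
  qed
  show "canon X v u" if "Ax_5 \<in> X" "canon X w v" "canon X w u"
  proof -
    have w: "max_theory X w" "max_theory X v" "max_theory X u"
      using that(2,3) by (auto simp: canon_def)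
    have "Dia A \<in> v" if "A \<in> u" for A
    proof -
      have "Dia A \<in> w" using \<open>canon X w u\<close> that canon_Dia[OF w(1)] by blast
      then have "Box (Dia A) \<in> w"
        using max_theory_ax[OF w(1) \<open>Ax_5 \<in> X\<close>, of A] by (simp add: max_theory_Imp[OF w(1)])
      then show ?thesis using \<open>canon X w v\<close> by (simp add: canon_def)
    qed
    then show ?thesis by (intro canonI w)
  qed
qed

lemma hilbert_complete:
  assumes "\<And>w. max_theory X w \<Longrightarrow> fsat (canon X) (\<lambda>p w. Pos p \<in> w) w F"
  shows "hilbert X F"
proof (rule ccontr)
  assume "\<not> hilbert X F"
  then have "\<not> ded X {} F" using ded_empty by blast
  then obtain w where w: "max_theory X w" and "F \<notin> w" by (rule lindenbaum)
  then show False using assms[OF w] truth_lemma[OF w, of F] by simp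
qed

theorem theorem2p36:
  fixes X :: "modal_ax set" and S :: "'p nseq" and q :: 'p and F :: "'p fm"
  assumes "nested X S"
    and "corr_fm q S F"
  shows "hilbert X F"
proof (rule hilbert_complete)
  fix w :: "'p fm set"
  assume "max_theory X w"
  then show "fsat (canon X) (\<lambda>p w. Pos p \<in> w) w F"
    unfolding fsat_corr_fm[OF assms(2)]
    by (intro frame.nested_sound[OF canon_frame assms(1)]) simp
qed

end
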